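(* Let $(X,\|\cdot\|)$ be a Banach space and let $f,g:X\to\mathbb{R}\cup\{+\infty\}$ be proper, convex and lower semicontinuous. If $\partial g(x)\subset\partial f(x)$ for all $x\in X$, then there is a constant $c\in\mathbb{R}$ such that $f(x)=g(x)+c$ for all $x\in X$.
   Context: For a convex $f:X\to\mathbb{R}\cup\{+\infty\}$ and $x_0\in\operatorname{dom} f:=\{x:f(x)<+\infty\}$, the subdifferential is $\partial f(x_0):=\{p\in X^*:\ p(x-x_0)\le f(x)-f(x_0)\ \forall x\in X\}$, and $\partial f(x_0):=\varnothing$ if $x_0\notin\operatorname{dom} f$. *)

theory Defs
  imports "HOL-Analysis.Analysis"
begin

text \<open>Extended-real valued functions X -> R \<union> {+\<infinity>} are modelled as maps into ereal
  that never take the value -\<infinity>.\<close>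

definition edom :: "('a \<Rightarrow> ereal) \<Rightarrow> 'a set" where
  "edom f = {x. f x < \<infinity>}"

definition proper_fun :: "('a \<Rightarrow> ereal) \<Rightarrow> bool" where
  "proper_fun f \<longleftrightarrow> (\<forall>x. f x \<noteq> -\<infinity>) \<and> edom f \<noteq> {}"

definition econvex :: "('a::real_vector \<Rightarrow> ereal) \<Rightarrow> bool" where
  "econvex f \<longleftrightarrow> (\<forall>x y. \<forall>t::real. 0 < t \<and> t < 1 \<longrightarrow>
      f ((1 - t) *\<^sub>R x + t *\<^sub>R y) \<le> ereal (1 - t) * f x + ereal t * f y)"

definition lsc :: "('a::topological_space \<Rightarrow> ereal) \<Rightarrow> bool" where
  "lsc f \<longleftrightarrow> (\<forall>c::ereal. closed {x. f x \<le> c})"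

definition subdiff :: "('a::real_normed_vector \<Rightarrow> ereal) \<Rightarrow> 'a \<Rightarrow> ('a \<Rightarrow> real) set" where
  "subdiff f x0 = (if x0 \<in> edom f then
     {p. bounded_linear p \<and> (\<forall>x. ereal (p (x - x0)) \<le> f x - f x0)} else {})"

end

theory Submission
  imports Defs
begin

text \<open>For large \<open>K\<close> let \<open>f\<^sub>K(y) = inf\<^sub>w (f(w) + K \<parallel>w - y\<parallel>)\<close> and likewise \<open>g\<^sub>K\<close>; these are
  finite and \<open>K\<close>-Lipschitz. Applying Ekeland's principle and a Hahn--Banach sandwich to
  \<open>g + K \<parallel>\<cdot> - y\<parallel>\<close> yields \<open>p \<in> \<partial>g(x)\<close> which, up to an arbitrarily small error, is a subgradient at \<open>y\<close>
  of \<open>g\<^sub>K\<close> and, since also \<open>p \<in> \<partial>f(x)\<close>, of \<open>f\<^sub>K\<close>. Hence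
  \<open>f\<^sub>K(y + h) - f\<^sub>K(y) \<ge> g\<^sub>K(y) - g\<^sub>K(y - h)\<close>. Summing this along a fine subdivision of a segment
  telescopes to \<open>f\<^sub>K(b) - f\<^sub>K(a) \<ge> g\<^sub>K(b) - g\<^sub>K(a)\<close>; exchanging \<open>a\<close> and \<open>b\<close>, \<open>f\<^sub>K - g\<^sub>K\<close> is constant.
  Lower semicontinuity gives \<open>f\<^sub>K \<longlonglongrightarrow> f\<close> and \<open>g\<^sub>K \<longlonglongrightarrow> g\<close> as \<open>K \<longlonglongrightarrow> \<infinity>\<close>.\<close>

section \<open>A Hahn--Banach sandwich theorem\<close>

text \<open>Homogeneity is an inequality for \<open>s > 0\<close> only, the form that passes
  directly to infima; applying it to \<open>1/s\<close> as well turns it into an equality.\<close>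

definition sublinear :: "('a::real_vector \<Rightarrow> real) \<Rightarrow> bool" where
  "sublinear q \<longleftrightarrow> (\<forall>x y. q (x + y) \<le> q x + q y) \<and> (\<forall>s>0. \<forall>x. q (s *\<^sub>R x) \<le> s * q x)"

lemma sublinear_zero:
  assumes "sublinear q" shows "q 0 = 0"
proof -
  have "q (0 + 0) \<le> q 0 + q 0" using assms unfolding sublinear_def by blast
  moreover have "q ((1/2) *\<^sub>R 0) \<le> (1/2) * q 0" using assms unfolding sublinear_def
    by (metis half_gt_zero zero_less_one)
  ultimately show ?thesis by simp
qed

lemma sublinear_scale:
  assumes q: "sublinear q" and s: "s \<ge> 0" shows "q (s *\<^sub>R x) = s * q x"
proof (cases "s = 0")
  case True then show ?thesis using sublinear_zero[OF q] by simp
next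
  case False
  then have s: "s > 0" using s by simp
  have "q ((1/s) *\<^sub>R (s *\<^sub>R x)) \<le> (1/s) * q (s *\<^sub>R x)"
    using q s unfolding sublinear_def by (meson zero_less_divide_1_iff)
  then have "s * q x \<le> q (s *\<^sub>R x)" using s by (simp add: field_simps)
  moreover have "q (s *\<^sub>R x) \<le> s * q x" using q s unfolding sublinear_def by blast
  ultimately show ?thesis by simp
qed

lemma sublinear_minus_le:
  assumes q: "sublinear q" shows "- q (- x) \<le> q x"
proof -
  have "q (x + (- x)) \<le> q x + q (- x)" using q unfolding sublinear_def by blast
  then show ?thesis using sublinear_zero[OF q] by simp
qed

text \<open>Two members nearly attaining the infima at \<open>x\<close> and at \<open>y\<close> may
  differ; directedness supplies one \<open>m\<close> below both, and subadditivity of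
  \<open>m\<close> gives the bound. Chains in the Zorn argument are directed in this sense.\<close>

lemma sublinear_INF:
  fixes Q :: "('a::real_vector \<Rightarrow> real) set"
  assumes ne: "Q \<noteq> {}" and sub: "\<And>q. q \<in> Q \<Longrightarrow> sublinear q"
    and bdd: "\<And>x. bdd_below ((\<lambda>q. q x) ` Q)"
    and dir: "\<And>q r. q \<in> Q \<Longrightarrow> r \<in> Q \<Longrightarrow> \<exists>m\<in>Q. m \<le> q \<and> m \<le> r"
  shows "sublinear (\<lambda>x. INF q\<in>Q. q x)"
  unfolding sublinear_def
proof (intro conjI allI impI)
  fix x y
  show "(INF q\<in>Q. q (x + y)) \<le> (INF q\<in>Q. q x) + (INF q\<in>Q. q y)"
  proof -
    have *: "(INF q\<in>Q. q (x + y)) \<le> q x + r y" if qr: "q \<in> Q" "r \<in> Q" for q r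
    proof -
      obtain m where m: "m \<in> Q" "m \<le> q" "m \<le> r" using dir[OF qr] by blast
      have "(INF q\<in>Q. q (x + y)) \<le> m (x + y)" using bdd m(1) by (rule cINF_lower)
      also have "\<dots> \<le> m x + m y" using sub[OF m(1)] unfolding sublinear_def by blast
      also have "\<dots> \<le> q x + r y" using m(2,3) by (simp add: le_funD add_mono)
      finally show ?thesis .
    qed
    have "(INF q\<in>Q. q (x + y)) - (INF q\<in>Q. q y) \<le> q x" if "q \<in> Q" for q
    proof -
      have "(INF q\<in>Q. q (x + y)) - q x \<le> (INF r\<in>Q. r y)"
        by (rule cINF_greatest[OF ne]) (use *[OF that] in \<open>simp add: algebra_simps\<close>)
      then show ?thesis by simp
    qed
    then have "(INF q\<in>Q. q (x + y)) - (INF q\<in>Q. q y) \<le> (INF q\<in>Q. q x)"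
      by (rule cINF_greatest[OF ne])
    then show ?thesis by simp
  qed
next
  fix s :: real and x assume s: "s > 0"
  have "(INF q\<in>Q. q (s *\<^sub>R x)) / s \<le> q x" if "q \<in> Q" for q
  proof -
    have "(INF q\<in>Q. q (s *\<^sub>R x)) \<le> q (s *\<^sub>R x)" using bdd that by (rule cINF_lower)
    also have "\<dots> \<le> s * q x" using sub[OF that] s unfolding sublinear_def by blast
    finally show ?thesis using s by (simp add: field_simps)
  qed
  then have "(INF q\<in>Q. q (s *\<^sub>R x)) / s \<le> (INF q\<in>Q. q x)"
    by (rule cINF_greatest[OF ne])
  then show "(INF q\<in>Q. q (s *\<^sub>R x)) \<le> s * (INF q\<in>Q. q x)"
    using s by (simp add: field_simps)
qed

text \<open>The functional \<open>q\<close> is lowered as far as the value \<open>q a\<close> in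
  direction \<open>a\<close> permits: the infimum of \<open>q (v + t a) - t * q a\<close> over
  \<open>t \<ge> 0\<close> stays sublinear, and \<open>t = 1\<close> at \<open>v = - a\<close>
  yields the bound. This will force a minimal sublinear functional to be odd.\<close>

lemma sublinear_lower_toward:
  fixes q :: "'a::real_vector \<Rightarrow> real"
  assumes q: "sublinear q"
  obtains r where "sublinear r" "r \<le> q" "r (- a) \<le> - q a"
proof
  define r where "r = (\<lambda>v. INF t\<in>{0..}. q (v + t *\<^sub>R a) - t * q a)"
  have bdd: "bdd_below ((\<lambda>t. q (v + t *\<^sub>R a) - t * q a) ` {0..})" for v
  proof (rule bdd_belowI2[where m = "- q (- v)"])
    fix t :: real assume "t \<in> {0..}"
    then have "t * q a = q (t *\<^sub>R a)" using sublinear_scale[OF q] by simp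
    also have "\<dots> = q ((v + t *\<^sub>R a) + (- v))" by simp
    also have "\<dots> \<le> q (v + t *\<^sub>R a) + q (- v)" using q unfolding sublinear_def by blast
    finally show "- q (- v) \<le> q (v + t *\<^sub>R a) - t * q a" by simp
  qed
  have lower: "r v \<le> q (v + t *\<^sub>R a) - t * q a" if "t \<ge> 0" for v t
    unfolding r_def by (rule cINF_lower[OF bdd]) (use that in simp)
  show "r \<le> q" using lower[of 0] by (simp add: le_fun_def)
  show "r (- a) \<le> - q a" using lower[of 1 "- a"] sublinear_zero[OF q] by simp
  show "sublinear r" unfolding sublinear_def
  proof (intro conjI allI impI)
    fix x y
    \<comment> \<open>The parameters of the two near-optimal choices add up: \<open>t + u\<close> is
      admissible for \<open>x + y\<close>.\<close>
    have *: "r (x + y) \<le> (q (x + t *\<^sub>R a) - t * q a) + (q (y + u *\<^sub>R a) - u * q a)"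
      if "t \<ge> 0" "u \<ge> 0" for t u
    proof -
      have "r (x + y) \<le> q ((x + y) + (t + u) *\<^sub>R a) - (t + u) * q a"
        using lower that by simp
      also have "(x + y) + (t + u) *\<^sub>R a = (x + t *\<^sub>R a) + (y + u *\<^sub>R a)"
        by (simp add: algebra_simps)
      also have "q \<dots> \<le> q (x + t *\<^sub>R a) + q (y + u *\<^sub>R a)"
        using q unfolding sublinear_def by blast
      finally show ?thesis by (simp add: algebra_simps)
    qed
    have "r (x + y) - r y \<le> q (x + t *\<^sub>R a) - t * q a" if "t \<ge> 0" for t
    proof -
      have "r (x + y) - (q (x + t *\<^sub>R a) - t * q a) \<le> r y" unfolding r_def
        by (rule cINF_greatest) (use *[OF that] in \<open>auto simp: r_def algebra_simps\<close>)
      then show ?thesis by simp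
    qed
    then have "r (x + y) - r y \<le> r x" 
      by (subst (3) r_def, intro cINF_greatest) auto
    then show "r (x + y) \<le> r x + r y" by simp
  next
    fix s :: real and x assume s: "s > 0"
    have "r (s *\<^sub>R x) / s \<le> q (x + t *\<^sub>R a) - t * q a" if "t \<ge> 0" for t
    proof -
      have "r (s *\<^sub>R x) \<le> q (s *\<^sub>R x + (s * t) *\<^sub>R a) - (s * t) * q a"
        using lower s that by simp
      also have "s *\<^sub>R x + (s * t) *\<^sub>R a = s *\<^sub>R (x + t *\<^sub>R a)" by (simp add: algebra_simps)
      also have "q \<dots> = s * q (x + t *\<^sub>R a)" using sublinear_scale[OF q] s by simp
      finally show ?thesis using s by (simp add: field_simps)
    qed
    then have "r (s *\<^sub>R x) / s \<le> r x"
      by (subst (2) r_def, intro cINF_greatest) auto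
    then show "r (s *\<^sub>R x) \<le> s * r x" using s by (simp add: field_simps)
  qed
qed

text \<open>Zorn's lemma gives a minimal sublinear functional below \<open>q\<close>. Minimality
  makes it odd, and an odd sublinear functional is linear.\<close>

theorem hahn_banach_sublinear:
  fixes q :: "'a::real_vector \<Rightarrow> real"
  assumes q: "sublinear q"
  obtains p where "linear p" "p \<le> q"
proof -
  define A where "A = {r. sublinear r \<and> r \<le> q}"
  \<comment> \<open>The order is reversed, so that a maximal element for \<open>?P\<close> is a
    pointwise minimal functional.\<close>
  let ?P = "\<lambda>x y::'a \<Rightarrow> real. y \<le> x"
  have "\<exists>m\<in>A. \<forall>a\<in>A. ?P m a \<longrightarrow> a = m"
  proof (rule predicate_Zorn)
    show "partial_order_on A (relation_of ?P A)"
      by (rule partial_order_on_relation_ofI) auto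
    fix C assume C: "C \<in> Chains (relation_of ?P A)"
    then have CA: "C \<subseteq> A" and tot: "\<And>r s. r \<in> C \<Longrightarrow> s \<in> C \<Longrightarrow> r \<le> s \<or> s \<le> r"
      unfolding Chains_def relation_of_def by auto
    show "\<exists>u\<in>A. \<forall>a\<in>C. ?P a u"
    proof (cases "C = {}")
      case True
      then show ?thesis using q unfolding A_def by auto
    next
      case False
      have bdd: "bdd_below ((\<lambda>r. r x) ` C)" for x
      proof (rule bdd_belowI2[where m = "- q (- x)"])
        fix r assume "r \<in> C"
        then have "sublinear r" "r \<le> q" using CA unfolding A_def by auto
        then show "- q (- x) \<le> r x"
          using sublinear_minus_le[of r x] le_funD[of r q "- x"] by simp
      qed
      let ?u = "\<lambda>x. INF r\<in>C. r x"
      have le: "?u \<le> r" if "r \<in> C" for r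
        using that bdd by (auto simp: le_fun_def intro: cINF_lower)
      have "sublinear ?u"
      proof (rule sublinear_INF[OF False])
        show "\<And>r. r \<in> C \<Longrightarrow> sublinear r" using CA unfolding A_def by auto
        show "\<exists>m\<in>C. m \<le> r \<and> m \<le> s" if "r \<in> C" "s \<in> C" for r s
          using tot[OF that] that by blast
      qed (rule bdd)
      moreover have "?u \<le> q"
      proof -
        obtain r where "r \<in> C" using False by blast
        moreover have "r \<le> q" using CA \<open>r \<in> C\<close> unfolding A_def by auto
        ultimately show ?thesis using le order_trans by blast
      qed
      ultimately have "?u \<in> A" unfolding A_def by simp
      then show ?thesis using le by blast
    qed
  qed
  then obtain p where pA: "p \<in> A" and min: "\<And>r. r \<in> A \<Longrightarrow> r \<le> p \<Longrightarrow> r = p" by blast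
  have p: "sublinear p" and pq: "p \<le> q" using pA unfolding A_def by auto
  have odd: "p (- a) = - p a" for a
  proof -
    obtain r where r: "sublinear r" "r \<le> p" "r (- a) \<le> - p a"
      using sublinear_lower_toward[OF p] by metis
    then have "r = p" using min pq unfolding A_def by auto
    then have "p (- a) \<le> - p a" using r by simp
    then show ?thesis using sublinear_minus_le[OF p, of a] by simp
  qed
  have "linear p"
  proof (rule linearI)
    fix x y
    \<comment> \<open>Subadditivity at \<open>- x\<close> and \<open>- y\<close> becomes, by
      oddness, the reverse inequality at \<open>x\<close> and \<open>y\<close>.\<close>
    have "p (x + y) \<le> p x + p y" and "p (- x + - y) \<le> p (- x) + p (- y)"
      using p unfolding sublinear_def by blast+
    moreover have "p (- x + - y) = - p (x + y)" using odd[of "x + y"] by simp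
    ultimately show "p (x + y) = p x + p y" using odd by simp
  next
    fix s x
    show "p (s *\<^sub>R x) = s *\<^sub>R p x"
    proof (cases "s \<ge> 0")
      case True
      then show ?thesis using sublinear_scale[OF p] by simp
    next
      case False
      then have "p ((- s) *\<^sub>R x) = (- s) * p x" by (intro sublinear_scale[OF p]) simp
      moreover have "p (s *\<^sub>R x) = - p ((- s) *\<^sub>R x)" by (simp add: odd)
      ultimately show ?thesis by simp
    qed
  qed
  then show thesis using that pq by blast
qed

section \<open>Linear minorants of convex functions and the sandwich at a minimizer\<close>

text \<open>\<open>S\<close> is the one-sided directional derivative of \<open>\<psi>\<close> at 0,
  written as the infimum of the difference quotients. It is sublinear and, by \<open>t = 1\<close>,
  lies below \<open>\<psi>\<close>, so the sublinear case applies to it.\<close>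

lemma hahn_banach_convex:
  fixes \<psi> :: "'a::real_vector \<Rightarrow> real"
  assumes conv: "convex_on UNIV \<psi>" and zero: "\<psi> 0 = 0"
  obtains p where "linear p" "p \<le> \<psi>"
proof -
  define S where "S = (\<lambda>v. INF t\<in>{0<..}. \<psi> (t *\<^sub>R v) / t)"
  have cx: "\<psi> (u *\<^sub>R x + v *\<^sub>R y) \<le> u * \<psi> x + v * \<psi> y"
    if "u \<ge> 0" "v \<ge> 0" "u + v = 1" for u v x y
    using conv that unfolding convex_on_def by blast
  have bdd: "bdd_below ((\<lambda>t. \<psi> (t *\<^sub>R v) / t) ` {0<..})" for v
  proof (rule bdd_belowI2[where m = "- \<psi> (- v)"])
    fix t :: real assume "t \<in> {0<..}"
    then have t: "t > 0" by simp
    \<comment> \<open>The origin is a convex combination of \<open>t v\<close> and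
      \<open>- v\<close>, so convexity bounds every quotient below by
      \<open>- \<psi> (- v)\<close>.\<close>
    have "(1 / (1 + t)) *\<^sub>R (t *\<^sub>R v) + (t / (1 + t)) *\<^sub>R (- v) = 0" by simp
    moreover have "\<psi> ((1 / (1 + t)) *\<^sub>R (t *\<^sub>R v) + (t / (1 + t)) *\<^sub>R (- v))
        \<le> (1 / (1 + t)) * \<psi> (t *\<^sub>R v) + (t / (1 + t)) * \<psi> (- v)"
      using t by (intro cx) (auto simp: field_simps)
    ultimately have "0 \<le> (1 / (1 + t)) * \<psi> (t *\<^sub>R v) + (t / (1 + t)) * \<psi> (- v)"
      using zero by simp
    also have "\<dots> = (\<psi> (t *\<^sub>R v) + t * \<psi> (- v)) / (1 + t)" by (simp add: add_divide_distrib)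
    finally have "0 \<le> \<psi> (t *\<^sub>R v) + t * \<psi> (- v)" using t by (simp add: zero_le_divide_iff)
    then show "- \<psi> (- v) \<le> \<psi> (t *\<^sub>R v) / t" using t by (simp add: field_simps)
  qed
  have lower: "S v \<le> \<psi> (t *\<^sub>R v) / t" if "t > 0" for v t
    unfolding S_def by (rule cINF_lower[OF bdd]) (use that in simp)
  have greatest: "m \<le> S v" if "\<And>t. t > 0 \<Longrightarrow> m \<le> \<psi> (t *\<^sub>R v) / t" for m v
    unfolding S_def by (rule cINF_greatest) (use that in auto)
  have "sublinear S" unfolding sublinear_def
  proof (intro conjI allI impI)
    fix x y
    have *: "S (x + y) \<le> \<psi> (t *\<^sub>R x) / t + \<psi> (s *\<^sub>R y) / s" if t: "t > 0" and s: "s > 0" for t s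
    proof -
      \<comment> \<open>With \<open>1/r = 1/t + 1/s\<close>, the point \<open>r (x + y)\<close> is a
        convex combination of \<open>t x\<close> and \<open>s y\<close>.\<close>
      define r where "r = t * s / (t + s)"
      have r: "r > 0" using t s unfolding r_def by simp
      have eq: "r *\<^sub>R (x + y) = (s / (t + s)) *\<^sub>R (t *\<^sub>R x) + (t / (t + s)) *\<^sub>R (s *\<^sub>R y)"
        unfolding r_def by (simp add: algebra_simps)
      have "\<psi> (r *\<^sub>R (x + y)) \<le> (s / (t + s)) * \<psi> (t *\<^sub>R x) + (t / (t + s)) * \<psi> (s *\<^sub>R y)"
      proof -
        have "t + s \<noteq> 0" using t s by linarith
        then have "s / (t + s) + t / (t + s) = 1"
          by (simp add: add.commute flip: add_divide_distrib)
        then show ?thesis unfolding eq using t s by (intro cx) auto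
      qed
      also have "\<dots> = r * (\<psi> (t *\<^sub>R x) / t + \<psi> (s *\<^sub>R y) / s)"
      proof -
        have "s / (t + s) = r / t" "t / (t + s) = r / s" using t s by (simp_all add: r_def)
        then show ?thesis by (simp add: distrib_left)
      qed
      finally have "\<psi> (r *\<^sub>R (x + y)) / r \<le> \<psi> (t *\<^sub>R x) / t + \<psi> (s *\<^sub>R y) / s"
        using r by (simp add: pos_divide_le_eq mult.commute)
      then show ?thesis using lower[OF r, of "x + y"] by simp
    qed
    have "S (x + y) - S y \<le> \<psi> (t *\<^sub>R x) / t" if "t > 0" for t
    proof -
      have "S (x + y) - \<psi> (t *\<^sub>R x) / t \<le> S y"
        by (rule greatest) (use *[OF that] in \<open>simp add: algebra_simps\<close>)
      then show ?thesis by simp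
    qed
    then have "S (x + y) - S y \<le> S x" by (rule greatest)
    then show "S (x + y) \<le> S x + S y" by simp
  next
    fix s :: real and x assume s: "s > 0"
    have "S (s *\<^sub>R x) / s \<le> \<psi> (t *\<^sub>R x) / t" if t: "t > 0" for t
      using lower[of "t / s" "s *\<^sub>R x"] s t by (simp add: field_simps)
    then have "S (s *\<^sub>R x) / s \<le> S x" by (rule greatest)
    then show "S (s *\<^sub>R x) \<le> s * S x" using s by (simp add: field_simps)
  qed
  then obtain p where "linear p" "p \<le> S" using hahn_banach_sublinear by blast
  moreover have "S \<le> \<psi>" using lower[of 1] by (simp add: le_fun_def)
  ultimately show thesis using that order_trans by blast
qed

text \<open>Near-minimizers \<open>w\<close> for \<open>x\<close> and \<open>z\<close> for
  \<open>y\<close> are combined with the same weights as \<open>x\<close> and \<open>y\<close>;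
  joint convexity of \<open>g w + k (w - v)\<close> in \<open>w\<close> and \<open>v\<close> does
  the rest.\<close>

lemma convex_on_inf_convolution:
  fixes g :: "'a::real_vector \<Rightarrow> real" and k :: "'a \<Rightarrow> real"
  assumes g: "convex_on D g" and k: "convex_on UNIV k" and ne: "D \<noteq> {}"
    and bdd: "\<And>v. bdd_below ((\<lambda>w. g w + k (w - v)) ` D)"
  shows "convex_on UNIV (\<lambda>v. INF w\<in>D. g w + k (w - v))"
  unfolding convex_on_def
proof (intro conjI ballI allI impI)
  fix x y :: 'a and a b :: real
  assume a: "0 \<le> a" and b: "0 \<le> b" and ab: "a + b = 1"
  let ?I = "\<lambda>v. INF w\<in>D. g w + k (w - v)"
  have near: "\<exists>w\<in>D. g w + k (w - v) < ?I v + e" if "e > 0" for e :: real and v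
    by (rule iffD1[OF cINF_less_iff[OF ne bdd]]) (use that in simp)
  show "?I (a *\<^sub>R x + b *\<^sub>R y) \<le> a * ?I x + b * ?I y"
  proof (rule field_le_epsilon)
    fix e :: real assume e: "e > 0"
    obtain w where w: "w \<in> D" "g w + k (w - x) < ?I x + e" using near[OF e] by blast
    obtain z where z: "z \<in> D" "g z + k (z - y) < ?I y + e" using near[OF e] by blast
    have mem: "a *\<^sub>R w + b *\<^sub>R z \<in> D"
      using g w z a b ab unfolding convex_on_def convex_def by blast
    have "?I (a *\<^sub>R x + b *\<^sub>R y) \<le> g (a *\<^sub>R w + b *\<^sub>R z) + k ((a *\<^sub>R w + b *\<^sub>R z) - (a *\<^sub>R x + b *\<^sub>R y))"
      using bdd mem by (rule cINF_lower)
    also have "(a *\<^sub>R w + b *\<^sub>R z) - (a *\<^sub>R x + b *\<^sub>R y) = a *\<^sub>R (w - x) + b *\<^sub>R (z - y)"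
      by (simp add: algebra_simps)
    also have "g (a *\<^sub>R w + b *\<^sub>R z) \<le> a * g w + b * g z"
      using g w z a b ab unfolding convex_on_def by blast
    also have "k (a *\<^sub>R (w - x) + b *\<^sub>R (z - y)) \<le> a * k (w - x) + b * k (z - y)"
      using k a b ab unfolding convex_on_def by blast
    also have "a * g w + b * g z + (a * k (w - x) + b * k (z - y))
        = a * (g w + k (w - x)) + b * (g z + k (z - y))" by (simp add: algebra_simps)
    also have "\<dots> \<le> a * (?I x + e) + b * (?I y + e)"
      using w(2) z(2) a b by (intro add_mono[OF mult_left_mono mult_left_mono]) auto
    also have "\<dots> = a * ?I x + b * ?I y + (a + b) * e" by (simp add: algebra_simps)
    finally show "?I (a *\<^sub>R x + b *\<^sub>R y) \<le> a * ?I x + b * ?I y + e" using ab by simp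
  qed
qed simp

text \<open>\<open>I v\<close> is the optimal value after shifting \<open>k\<close> by
  \<open>v\<close>. It is finite because \<open>k\<close> is Lipschitz, it is convex, and
  \<open>I 0 = g x + k x\<close>. A linear \<open>p\<close> below \<open>I - I 0\<close> is a
  subgradient of \<open>g\<close> at \<open>x\<close> (test \<open>w = u\<close>,
  \<open>v = u - x\<close>), and \<open>- p\<close> is one of \<open>k\<close> at \<open>x\<close>
  (test \<open>w = x\<close>, \<open>v = x - u\<close>).\<close>

lemma sandwich_at_minimizer:
  fixes g k :: "'a::real_normed_vector \<Rightarrow> real"
  assumes g: "convex_on D g" and k: "convex_on UNIV k"
    and lip: "\<And>u v. k u - k v \<le> L * norm (u - v)"
    and x: "x \<in> D" and min: "\<And>u. u \<in> D \<Longrightarrow> g x + k x \<le> g u + k u"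
  obtains p where "linear p" "\<And>u. u \<in> D \<Longrightarrow> p (u - x) \<le> g u - g x"
    "\<And>u. - p (u - x) \<le> k u - k x"
proof -
  have bdd: "bdd_below ((\<lambda>w. g w + k (w - v)) ` D)" for v
  proof (rule bdd_belowI2[where m = "g x + k x - L * norm v"])
    fix w assume "w \<in> D"
    then have "g x + k x \<le> g w + k w" by (rule min)
    moreover have "k w - k (w - v) \<le> L * norm v" using lip[of w "w - v"] by simp
    ultimately show "g x + k x - L * norm v \<le> g w + k (w - v)" by simp
  qed
  define I where "I = (\<lambda>v. INF w\<in>D. g w + k (w - v))"
  have I: "convex_on UNIV I" unfolding I_def
    using g k _ bdd by (rule convex_on_inf_convolution) (use x in auto)
  have lower: "I v \<le> g w + k (w - v)" if "w \<in> D" for v w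
    unfolding I_def using bdd that by (rule cINF_lower)
  have I0: "I 0 = g x + k x"
  proof (rule antisym)
    show "I 0 \<le> g x + k x" using lower[OF x, of 0] by simp
    show "g x + k x \<le> I 0" unfolding I_def by (rule cINF_greatest) (use x min in auto)
  qed
  have "convex_on UNIV (\<lambda>v. I v - I 0)"
    using I unfolding convex_on_def by (smt (verit) distrib_right mult_cancel_right1 right_diff_distrib)
  then obtain p where p: "linear p" "p \<le> (\<lambda>v. I v - I 0)"
    using hahn_banach_convex[of "\<lambda>v. I v - I 0"] by auto
  have pI: "p v \<le> I v - I 0" for v using p(2) by (simp add: le_fun_def)
  show thesis
  proof
    show "linear p" by fact
    show "p (u - x) \<le> g u - g x" if "u \<in> D" for u
      using pI[of "u - x"] lower[OF that, of "u - x"] I0 by simp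
    show "- p (u - x) \<le> k u - k x" for u
      using pI[of "x - u"] lower[OF x, of "x - u"] I0 linear_neg[OF p(1), of "u - x"] by simp
  qed
qed

section \<open>Ekeland's variational principle\<close>

text \<open>Closed sets \<open>{x\<in>D. g x \<le> c}\<close> express lower semicontinuity of
  \<open>g\<close> extended by +infinity outside \<open>D\<close>. Along a convergent sequence
  \<open>k\<close> is eventually above \<open>k l - e\<close>, so the limit lies in the sublevel set
  of \<open>g\<close> at \<open>c - k l + e\<close> for every \<open>e > 0\<close>.\<close>

lemma closed_sublevel_add:
  fixes g k :: "'a::metric_space \<Rightarrow> real"
  assumes g: "\<And>c. closed {x\<in>D. g x \<le> c}" and k: "continuous_on UNIV k"
  shows "closed {x\<in>D. g x + k x \<le> c}"
  unfolding closed_sequential_limits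
proof (intro allI impI)
  fix X l assume "(\<forall>n. X n \<in> {x \<in> D. g x + k x \<le> c}) \<and> X \<longlonglongrightarrow> l"
  then have X: "\<And>n. X n \<in> D" "\<And>n. g (X n) + k (X n) \<le> c" and l: "X \<longlonglongrightarrow> l" by auto
  have kl: "(\<lambda>n. k (X n)) \<longlonglongrightarrow> k l"
    using continuous_on_tendsto_compose[OF k l] by simp
  have *: "l \<in> {x\<in>D. g x \<le> c - k l + e}" if e: "e > 0" for e
  proof (rule Lim_in_closed_set[OF g _ _ l])
    have "\<forall>\<^sub>F n in sequentially. k l - e < k (X n)"
      using kl e by (intro order_tendstoD) auto
    then show "\<forall>\<^sub>F n in sequentially. X n \<in> {x\<in>D. g x \<le> c - k l + e}"
    proof eventually_elim
      case (elim n)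
      then show ?case using X[of n] by auto
    qed
  qed simp
  have "l \<in> D" using *[of 1] by simp
  moreover have "g l \<le> c - k l" by (rule field_le_epsilon) (use * in auto)
  ultimately show "l \<in> {x \<in> D. g x + k x \<le> c}" by simp
qed

text \<open>\<open>S x\<close> collects the points that improve on \<open>x\<close> by at least
  \<eta> times their distance from it. These closed sets decrease along a sequence of
  near-minimizers and shrink to a single point, on which no other point can improve in this
  sense.\<close>

theorem ekeland:
  fixes g :: "'a::complete_space \<Rightarrow> real"
  assumes lsc: "\<And>c. closed {x\<in>D. g x \<le> c}" and bdd: "bdd_below (g ` D)"
    and v: "v \<in> D" and \<eta>: "\<eta> > 0"
  obtains x where "x \<in> D" "g x \<le> g v" "\<And>u. u \<in> D \<Longrightarrow> g x \<le> g u + \<eta> * dist u x"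
proof -
  define S where "S = (\<lambda>x. {u\<in>D. g u + \<eta> * dist u x \<le> g x})"
  have closedS: "closed (S x)" for x
    unfolding S_def by (rule closed_sublevel_add[OF lsc]) (intro continuous_intros)
  have refl: "x \<in> S x" if "x \<in> D" for x using that unfolding S_def by simp
  have trans: "w \<in> S x" if "w \<in> S u" "u \<in> S x" for w u x
  proof -
    have "\<eta> * dist w x \<le> \<eta> * dist w u + \<eta> * dist u x"
      using \<eta> dist_triangle[of w x u] by (simp flip: distrib_left)
    then show ?thesis using that unfolding S_def by auto
  qed
  have SD: "S x \<subseteq> D" for x unfolding S_def by auto
  \<comment> \<open>The next point minimizes \<open>g\<close> over \<open>S x\<close> up to
    \<open>(1/2)^n\<close>; any error tending to 0 would serve.\<close>
  have step: "\<exists>y. y \<in> S x \<and> (\<forall>u\<in>S x. g y \<le> g u + (1/2)^n)" if "x \<in> D" for x and n :: nat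
  proof -
    have ne: "g ` S x \<noteq> {}" using refl that by blast
    have b: "bdd_below (g ` S x)" using bdd SD by (meson bdd_below_mono image_mono)
    have "Inf (g ` S x) < Inf (g ` S x) + (1/2)^n" by simp
    then obtain y where y: "y \<in> S x" "g y < Inf (g ` S x) + (1/2)^n"
      using cInf_lessD[OF ne] by blast
    moreover have "Inf (g ` S x) \<le> g u" if "u \<in> S x" for u
      using b that by (simp add: cInf_lower)
    ultimately show ?thesis by (meson add_right_mono less_imp_le order_trans)
  qed
  define X where "X = rec_nat v (\<lambda>n x. SOME y. y \<in> S x \<and> (\<forall>u\<in>S x. g y \<le> g u + (1/2)^n))"
  have X0: "X 0 = v" unfolding X_def by simp
  have X_Suc: "X (Suc n) = (SOME y. y \<in> S (X n) \<and> (\<forall>u\<in>S (X n). g y \<le> g u + (1/2)^n))" for n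
    unfolding X_def by simp
  have X_step: "X (Suc n) \<in> S (X n) \<and> (\<forall>u\<in>S (X n). g (X (Suc n)) \<le> g u + (1/2)^n)"
    if "X n \<in> D" for n
    unfolding X_Suc using step[OF that] by (rule someI_ex)
  have XD: "X n \<in> D" for n
  proof (induction n)
    case 0 then show ?case using v X0 by simp
  next
    case (Suc n) then show ?case using X_step SD by blast
  qed
  have XS: "X (Suc n) \<in> S (X n)" for n using X_step[OF XD] by simp
  have Xmin: "g (X (Suc n)) \<le> g u + (1/2)^n" if "u \<in> S (X n)" for n u
    using X_step[OF XD] that by simp
  have mono: "X m \<in> S (X n)" if "n \<le> m" for n m
    using that
  proof (induction m rule: dec_induct)
    case base show ?case by (rule refl[OF XD])
  next
    case (step m) then show ?case using trans[OF XS] by simp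
  qed
  \<comment> \<open>Since \<open>u\<close> also lies in \<open>S (X n)\<close>, near-minimality
    allows a decrease from \<open>X (Suc n)\<close> to \<open>u\<close> of at most
    \<open>(1/2)^n\<close>, and this decrease dominates \<eta> times the distance.\<close>
  have dist: "\<eta> * dist u (X (Suc n)) \<le> (1/2)^n" if "u \<in> S (X (Suc n))" for u n
  proof -
    have "u \<in> S (X n)" using trans[OF that XS] .
    then show ?thesis using Xmin[of u n] that unfolding S_def by auto
  qed
  have "Cauchy X"
  proof (rule metric_CauchyI)
    fix e :: real assume e: "e > 0"
    have "(\<lambda>n. (1/2)^n :: real) \<longlonglongrightarrow> 0" by (intro LIMSEQ_power_zero) auto
    then have "\<forall>\<^sub>F n in sequentially. (1/2)^n < \<eta> * e / 2"
      using \<eta> e by (intro order_tendstoD) auto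
    then obtain n where n: "(1/2)^n < \<eta> * e / 2" by (auto simp: eventually_sequentially)
    have *: "dist (X m) (X (Suc n)) < e / 2" if "Suc n \<le> m" for m
    proof -
      have "\<eta> * dist (X m) (X (Suc n)) < \<eta> * (e / 2)" using dist[OF mono[OF that]] n by simp
      then show ?thesis using \<eta> mult_less_cancel_left_pos by blast
    qed
    show "\<exists>M. \<forall>m\<ge>M. \<forall>n\<ge>M. dist (X m) (X n) < e"
      using * by (meson dist_triangle_half_l dist_commute)
  qed
  then obtain x where x: "X \<longlonglongrightarrow> x" using Cauchy_convergent convergent_def by blast
  have xS: "x \<in> S (X n)" for n
    by (rule Lim_in_closed_set[OF closedS _ _ x])
       (auto intro!: eventually_sequentiallyI[of n] mono)
  show thesis
  proof
    show "x \<in> D" using xS SD by blast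
    show "g x \<le> g v"
      using xS[of 0] \<eta> X0 zero_le_dist[of x v] unfolding S_def
      by (smt (verit) mem_Collect_eq mult_nonneg_nonneg)
    show "g x \<le> g u + \<eta> * dist u x" if u: "u \<in> D" for u
    proof (rule ccontr)
      assume c: "\<not> ?thesis"
      then have uS: "u \<in> S x" using u unfolding S_def by simp
      \<comment> \<open>By transitivity \<open>u\<close> lies in every \<open>S (X n)\<close>, so
        the distance bound applies to it. That bound concerns \<open>X (Suc n)\<close>, hence the
        shift by 1.\<close>
      have "X \<longlonglongrightarrow> u"
      proof (rule LIMSEQ_offset[where k = 1], rule metric_LIMSEQ_I)
        fix e :: real assume e: "e > 0"
        have "(\<lambda>n. (1/2)^n :: real) \<longlonglongrightarrow> 0" by (intro LIMSEQ_power_zero) auto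
        then have "\<forall>\<^sub>F n in sequentially. (1/2)^n < \<eta> * e"
          using \<eta> e by (intro order_tendstoD) auto
        then obtain N where N: "\<And>n. n \<ge> N \<Longrightarrow> (1/2)^n < \<eta> * e"
          by (auto simp: eventually_sequentially)
        have "dist (X (n + 1)) u < e" if "n \<ge> N" for n
        proof -
          have "\<eta> * dist u (X (Suc n)) < \<eta> * e"
            using dist[OF trans[OF uS xS], of n] N[OF that] by simp
          then show ?thesis using \<eta> by (simp add: dist_commute)
        qed
        then show "\<exists>no. \<forall>n\<ge>no. dist (X (n + 1)) u < e" by blast
      qed
      then have "u = x" using x LIMSEQ_unique by blast
      then show False using c by simp
    qed
  qed
qed

section \<open>Lipschitz envelopes\<close>

text \<open>The Pasch-Hausdorff envelope, that is, the inf-convolution of \<open>g\<close> with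
  \<open>K\<close> times the norm. Letting \<open>w\<close> range over the effective domain
  \<open>D\<close> keeps all values real; the real infimum is meaningful for nonempty
  \<open>D\<close> once the values are bounded below.\<close>

definition envelope :: "real \<Rightarrow> 'a::real_normed_vector set \<Rightarrow> ('a \<Rightarrow> real) \<Rightarrow> 'a \<Rightarrow> real" where
  "envelope K D g y = (INF w\<in>D. g w + K * norm (w - y))"

text \<open>By the triangle inequality a share \<open>K0\<close> of the penalty absorbs the decay of
  the minorant. The surplus slope \<open>K - K0\<close> makes the penalized function coercive when
  \<open>K0 < K\<close>.\<close>

lemma norm_minorant_shift:
  fixes y :: "'a::real_normed_vector"
  assumes "\<And>u. u \<in> D \<Longrightarrow> A - K0 * norm u \<le> g u" "K0 \<ge> 0" "w \<in> D"
  shows "A - K0 * norm y + (K - K0) * norm (w - y) \<le> g w + K * norm (w - y)"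
proof -
  have "K0 * norm w \<le> K0 * (norm y + norm (w - y))"
    using assms(2) norm_triangle_sub[of w y] by (intro mult_left_mono) auto
  then show ?thesis using assms(1)[OF assms(3)] by (simp add: algebra_simps)
qed

lemma bdd_below_envelope:
  assumes "\<And>u. u \<in> D \<Longrightarrow> A - K0 * norm u \<le> g u" "K0 \<ge> 0" "K0 \<le> K"
  shows "bdd_below ((\<lambda>w. g w + K * norm (w - y)) ` D)"
proof (rule bdd_belowI2[where m = "A - K0 * norm y"])
  fix w assume "w \<in> D"
  then show "A - K0 * norm y \<le> g w + K * norm (w - y)"
    using norm_minorant_shift[of D A K0 g w y K] assms
    by (smt (verit) mult_nonneg_nonneg norm_ge_zero)
qed

lemma envelope_le:
  assumes "\<And>u. u \<in> D \<Longrightarrow> A - K0 * norm u \<le> g u" "K0 \<ge> 0" "K0 \<le> K" "w \<in> D"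
  shows "envelope K D g y \<le> g w + K * norm (w - y)"
  unfolding envelope_def using bdd_below_envelope[OF assms(1-3)] assms(4) by (rule cINF_lower)

lemma envelope_greatest:
  assumes "D \<noteq> {}" "\<And>w. w \<in> D \<Longrightarrow> m \<le> g w + K * norm (w - y)"
  shows "m \<le> envelope K D g y"
  unfolding envelope_def using assms by (rule cINF_greatest)

text \<open>An infimum of functions of \<open>y\<close> that are all \<open>K\<close>-Lipschitz,
  finite by the minorant, is again \<open>K\<close>-Lipschitz.\<close>

lemma envelope_lipschitz:
  assumes m: "\<And>u. u \<in> D \<Longrightarrow> A - K0 * norm u \<le> g u" and K: "K0 \<ge> 0" "K0 \<le> K"
    and ne: "D \<noteq> {}"
  shows "envelope K D g y - envelope K D g z \<le> K * norm (y - z)"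
proof -
  have "envelope K D g y - K * norm (y - z) \<le> envelope K D g z"
  proof (rule envelope_greatest[OF ne])
    fix w assume w: "w \<in> D"
    have "norm (w - y) \<le> norm (w - z) + norm (y - z)"
      using norm_triangle_ineq4[of "w - z" "y - z"] by simp
    then have "K * norm (w - y) \<le> K * norm (w - z) + K * norm (y - z)"
      using K by (simp flip: distrib_left add: mult_left_mono)
    then show "envelope K D g y - K * norm (y - z) \<le> g w + K * norm (w - z)"
      using envelope_le[OF m K w, of y] by simp
  qed
  then show ?thesis by simp
qed

section \<open>Norm minorants and approximate subgradients of the envelope\<close>

text \<open>Lower semicontinuity keeps \<open>g\<close> above \<open>g y - 1\<close> on a ball of
  radius \<open>d\<close> around \<open>y\<close>. Along a segment leaving that ball, convexity then
  prevents \<open>g\<close> from falling faster than \<open>1/d\<close> per unit length.\<close>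

lemma norm_minorant_exists:
  fixes g :: "'a::real_normed_vector \<Rightarrow> real"
  assumes conv: "convex_on D g" and lsc: "\<And>c. closed {x\<in>D. g x \<le> c}" and y: "y \<in> D"
  obtains K A where "K \<ge> 0" "\<And>u. u \<in> D \<Longrightarrow> A - K * norm u \<le> g u"
proof -
  have "open (- {x\<in>D. g x \<le> g y - 1})" using lsc by (simp add: open_Compl)
  moreover have "y \<in> - {x\<in>D. g x \<le> g y - 1}" by simp
  ultimately obtain d where d: "d > 0" "cball y d \<subseteq> - {x\<in>D. g x \<le> g y - 1}"
    using open_contains_cball by blast
  have near: "g y - 1 < g u" if "u \<in> D" "norm (u - y) \<le> d" for u
  proof -
    have "u \<in> cball y d" using that by (simp add: dist_norm norm_minus_commute)
    then show ?thesis using d that by auto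
  qed
  show thesis
  proof
    show "1 / d \<ge> 0" using d by simp
    fix u assume u: "u \<in> D"
    show "g y - 1 - norm y / d - (1 / d) * norm u \<le> g u"
    proof (cases "norm (u - y) \<le> d")
      case True
      have "0 \<le> norm y / d" "0 \<le> (1 / d) * norm u" using d by simp_all
      then show ?thesis using near[OF u True] by simp
    next
      case False
      \<comment> \<open>This \<open>t\<close> places \<open>z\<close> on the segment from
        \<open>y\<close> to \<open>u\<close> at distance exactly \<open>d\<close> from
        \<open>y\<close>.\<close>
      define t where "t = d / norm (u - y)"
      have N: "norm (u - y) > 0" using False d by linarith
      have t: "0 < t" "t \<le> 1" using False d N unfolding t_def by auto
      define z where "z = (1 - t) *\<^sub>R y + t *\<^sub>R u"
      have "z - y = t *\<^sub>R (u - y)" unfolding z_def by (simp add: algebra_simps)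
      then have "norm (z - y) = d" using d(1) N unfolding t_def by simp
      moreover have "z \<in> D" using conv y u t unfolding z_def convex_on_def convex_def by simp
      ultimately have "g y - 1 < g z" using near by simp
      also have "g z \<le> (1 - t) * g y + t * g u"
        unfolding z_def using t u y by (intro convex_onD[OF conv]) auto
      finally have "- 1 < t * (g u - g y)" by (simp add: algebra_simps)
      then have "- 1 * norm (u - y) < d * (g u - g y)"
        using N unfolding t_def by (simp add: field_simps)
      then have "- norm (u - y) / d < g u - g y" using d by (simp add: field_simps)
      moreover have "norm (u - y) / d \<le> norm u / d + norm y / d"
        using d norm_triangle_ineq4[of u y] by (simp flip: add_divide_distrib add: divide_right_mono)
      ultimately show ?thesis by simp
    qed
  qed
qed

text \<open>The point \<open>x\<close> need not be close to \<open>y\<close>: it almost attains the infimum defining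
  the envelope at \<open>y\<close>, and \<open>p\<close> is an almost subgradient of the envelope there.
  The bound \<open>R\<close> does not depend on \<open>\<eta>\<close>.\<close>

lemma penalized_subgradient:
  fixes g :: "'a::banach \<Rightarrow> real"
  assumes conv: "convex_on D g" and lsc: "\<And>c. closed {x\<in>D. g x \<le> c}" and v: "v \<in> D"
    and m: "\<And>u. u \<in> D \<Longrightarrow> A - K0 * norm u \<le> g u" and K: "K0 \<ge> 0" "K0 < K"
  obtains R where "\<And>\<eta>. \<eta> > 0 \<Longrightarrow> \<exists>x\<in>D. \<exists>p. bounded_linear p \<and> (\<forall>u\<in>D. p (u - x) \<le> g u - g x)
    \<and> (\<forall>u. - (K + \<eta>) * norm u \<le> p u) \<and> (K - \<eta>) * norm (x - y) \<le> p (y - x) \<and> norm (x - y) \<le> R"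
proof
  define G where "G = (\<lambda>u. g u + K * norm (u - y))"
  fix \<eta> :: real assume \<eta>: "\<eta> > 0"
  have Glow: "A - K0 * norm y + (K - K0) * norm (u - y) \<le> G u" if "u \<in> D" for u
    unfolding G_def using m K(1) that by (rule norm_minorant_shift)
  have "closed {x\<in>D. G x \<le> c}" for c
    unfolding G_def by (rule closed_sublevel_add[OF lsc]) (intro continuous_intros)
  moreover have "bdd_below (G ` D)"
    unfolding G_def using m K by (intro bdd_below_envelope) auto
  ultimately obtain x where x: "x \<in> D" and xv: "G x \<le> G v"
    and min: "\<And>u. u \<in> D \<Longrightarrow> G x \<le> G u + \<eta> * dist u x"
    using ekeland[of D G v \<eta>] v \<eta> by metis
  \<comment> \<open>The penalty centred at \<open>y\<close> and the Ekeland term centred at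
    \<open>x\<close> form one convex Lipschitz function; Ekeland's conclusion says that
    \<open>x\<close> minimizes \<open>g + k\<close>.\<close>
  define k where "k = (\<lambda>u. K * dist y u + \<eta> * dist x u)"
  have "convex_on UNIV k"
    unfolding k_def using K \<eta> by (intro convex_on_add convex_on_cmul convex_on_dist) auto
  moreover have "k u - k w \<le> (K + \<eta>) * norm (u - w)" for u w
  proof -
    have "dist y u \<le> dist y w + norm (u - w)" "dist x u \<le> dist x w + norm (u - w)"
      by (metis dist_commute dist_norm dist_triangle)+
    then have "K * dist y u \<le> K * (dist y w + norm (u - w))"
      "\<eta> * dist x u \<le> \<eta> * (dist x w + norm (u - w))"
      using K \<eta> by (auto intro!: mult_left_mono)
    then show ?thesis unfolding k_def by (simp add: algebra_simps)
  qed
  moreover have "g x + k x \<le> g u + k u" if "u \<in> D" for u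
    using min[OF that] unfolding G_def k_def by (simp add: dist_norm norm_minus_commute)
  ultimately obtain p where p: "linear p" "\<And>u. u \<in> D \<Longrightarrow> p (u - x) \<le> g u - g x"
    and pk: "\<And>u. - p (u - x) \<le> k u - k x"
    using sandwich_at_minimizer[OF conv, of k "K + \<eta>" x] x by metis
  have lower: "- (K + \<eta>) * norm u \<le> p u" for u
  proof -
    have "K * norm (x + u - y) \<le> K * (norm (x - y) + norm u)"
      using K norm_triangle_ineq[of "x - y" u] by (intro mult_left_mono) (auto simp: algebra_simps)
    then show ?thesis using pk[of "x + u"] unfolding k_def
      by (simp add: dist_norm norm_minus_commute algebra_simps)
  qed
  \<comment> \<open>The lower bound at \<open>u\<close> and at \<open>- u\<close> together bound the
    absolute value of \<open>p u\<close>.\<close>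
  have "bounded_linear p"
  proof (rule bounded_linear_intro[where K = "K + \<eta>"])
    fix u show "norm (p u) \<le> norm u * (K + \<eta>)"
      using lower[of u] lower[of "- u"] linear_neg[OF p(1), of u]
      by (simp add: abs_le_iff algebra_simps)
  qed (use p(1) in \<open>simp_all add: linear_add linear_cmul\<close>)
  \<comment> \<open>At \<open>y\<close> the main penalty vanishes: \<open>k y\<close> is \<eta>
    times the distance from \<open>x\<close> to \<open>y\<close>, while \<open>k x\<close> is
    \<open>K\<close> times it.\<close>
  moreover have "(K - \<eta>) * norm (x - y) \<le> p (y - x)"
    using pk[of y] unfolding k_def by (simp add: dist_norm norm_minus_commute algebra_simps)
  \<comment> \<open>Coercivity of \<open>G\<close> and \<open>G x \<le> G v\<close> give a radius
    that does not involve \<eta>.\<close>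
  moreover have "norm (x - y) \<le> (G v - A + K0 * norm y) / (K - K0)"
    using Glow[OF x] xv K by (simp add: field_simps)
  ultimately show "\<exists>x\<in>D. \<exists>p. bounded_linear p \<and> (\<forall>u\<in>D. p (u - x) \<le> g u - g x)
    \<and> (\<forall>u. - (K + \<eta>) * norm u \<le> p u) \<and> (K - \<eta>) * norm (x - y) \<le> p (y - x)
    \<and> norm (x - y) \<le> (G v - A + K0 * norm y) / (K - K0)"
    using x p(2) lower by blast
qed

section \<open>Comparing the increments of the two envelopes\<close>

text \<open>One functional \<open>p\<close> supports both functions at the same \<open>x\<close>, so
  up to \<open>\<eta> * R\<close> it also supports both envelopes at \<open>y\<close>. Adding the
  two support inequalities, at \<open>u\<close> and at \<open>v\<close>, leaves
  \<open>p (u + v - 2 y)\<close>, which is at least \<open>- (K + \<eta>)\<close> times the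
  norm.\<close>

lemma envelope_sum_le:
  fixes f g :: "'a::banach \<Rightarrow> real"
  assumes conv: "convex_on D g" and lsc: "\<And>c. closed {x\<in>D. g x \<le> c}"
    and mg: "\<And>u. u \<in> D \<Longrightarrow> A - K0 * norm u \<le> g u"
    and mf: "\<And>u. u \<in> E \<Longrightarrow> B - K0 * norm u \<le> f u"
    and K: "K0 \<ge> 0" "K0 < K"
    and sub: "\<And>x p. x \<in> D \<Longrightarrow> bounded_linear p \<Longrightarrow> (\<And>u. u \<in> D \<Longrightarrow> p (u - x) \<le> g u - g x)
      \<Longrightarrow> x \<in> E \<and> (\<forall>u\<in>E. p (u - x) \<le> f u - f x)"
    and u: "u \<in> E" and v: "v \<in> D"
  shows "envelope K E f y + envelope K D g y \<le> f u + g v + K * norm (u + v - 2 *\<^sub>R y)"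
proof -
  obtain R where R: "\<And>\<eta>. \<eta> > 0 \<Longrightarrow> \<exists>x\<in>D. \<exists>p. bounded_linear p \<and> (\<forall>u\<in>D. p (u - x) \<le> g u - g x)
    \<and> (\<forall>u. - (K + \<eta>) * norm u \<le> p u) \<and> (K - \<eta>) * norm (x - y) \<le> p (y - x) \<and> norm (x - y) \<le> R"
    using penalized_subgradient[OF conv lsc v mg K] by metis
  let ?N = "norm (u + v - 2 *\<^sub>R y)"
  have "0 \<le> R" using R[of 1] norm_ge_zero order_trans by (metis zero_less_one)
  then have pos: "2 * R + ?N + 1 > 0" by (simp add: add_nonneg_pos)
  have K': "K0 \<le> K" using K by simp
  show ?thesis
  proof (rule field_le_epsilon)
    fix e :: real assume e: "e > 0"
    \<comment> \<open>The total error is \<eta> times \<open>2 * R + ?N\<close>, which this choice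
      keeps below \<open>e\<close>; the summand 1 makes the denominator positive.\<close>
    define \<eta> where "\<eta> = e / (2 * R + ?N + 1)"
    have \<eta>: "\<eta> > 0" using e pos unfolding \<eta>_def by simp
    obtain x p where x: "x \<in> D" and p: "bounded_linear p" "\<And>u. u \<in> D \<Longrightarrow> p (u - x) \<le> g u - g x"
      and plow: "\<And>u. - (K + \<eta>) * norm u \<le> p u"
      and px: "(K - \<eta>) * norm (x - y) \<le> p (y - x)" and xR: "norm (x - y) \<le> R"
      using R[OF \<eta>] by blast
    have xE: "x \<in> E" and pf: "\<And>u. u \<in> E \<Longrightarrow> p (u - x) \<le> f u - f x"
      using sub[OF x p] by auto
    have split: "p (w - x) = p (w - y) + p (y - x)" for w
      using linear_add[OF bounded_linear.linear[OF p(1)], of "w - y" "y - x"] by simp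
    have \<eta>R: "\<eta> * norm (x - y) \<le> \<eta> * R" using xR \<eta> by simp
    have px': "K * norm (x - y) - \<eta> * R \<le> p (y - x)"
      using px \<eta>R by (simp add: algebra_simps)
    have "envelope K E f y \<le> f u - p (u - y) + \<eta> * R"
      using envelope_le[OF mf K(1) K' xE, of y] pf[OF u] split[of u] px' by simp
    moreover have "envelope K D g y \<le> g v - p (v - y) + \<eta> * R"
      using envelope_le[OF mg K(1) K' x, of y] p(2)[OF v] split[of v] px' by simp
    moreover have "- (K + \<eta>) * ?N \<le> p (u - y) + p (v - y)"
    proof -
      have eq: "(u - y) + (v - y) = u + v - 2 *\<^sub>R y" by (simp add: scaleR_2)
      show ?thesis
        using plow[of "u + v - 2 *\<^sub>R y"]
          linear_add[OF bounded_linear.linear[OF p(1)], of "u - y" "v - y", unfolded eq] by simp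
    qed
    moreover have "\<eta> * (2 * R + ?N) \<le> e"
    proof -
      have "\<eta> * (2 * R + ?N + 1) = e" using pos unfolding \<eta>_def by simp
      then show ?thesis using \<eta> by (simp add: algebra_simps)
    qed
    ultimately show "envelope K E f y + envelope K D g y \<le> f u + g v + K * ?N + e"
      by (simp add: algebra_simps)
  qed
qed

text \<open>The hypothesis bounds a backward increment of \<open>G\<close> by a forward increment of
  \<open>F\<close>. Summing over equal steps from \<open>a\<close> to \<open>b\<close> telescopes;
  the one-step lag of \<open>G\<close> costs at most \<open>2 * K * norm h\<close> and vanishes as
  the subdivision is refined.\<close>

lemma increment_le_of_sum_le:
  fixes F G :: "'a::real_normed_vector \<Rightarrow> real"
  assumes lip: "\<And>y z. G y - G z \<le> K * norm (y - z)"
    and le: "\<And>y h. F y + G y \<le> F (y + h) + G (y - h)"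
  shows "G b - G a \<le> F b - F a"
proof -
  have *: "G b - G a \<le> F b - F a + 2 * K * norm (b - a) * inverse (real (Suc n))" for n
  proof -
    define h where "h = inverse (real (Suc n)) *\<^sub>R (b - a)"
    have step: "G (a + real k *\<^sub>R h - h) - G (a - h) \<le> F (a + real k *\<^sub>R h) - F a" for k
    proof (induction k)
      case (Suc k)
      have eq: "a + real (Suc k) *\<^sub>R h = (a + real k *\<^sub>R h) + h" by (simp add: algebra_simps)
      show ?case unfolding eq using Suc le[of "a + real k *\<^sub>R h" h] by simp
    qed simp
    have "real (Suc n) *\<^sub>R h = b - a" unfolding h_def by simp
    then have "G (b - h) - G (a - h) \<le> F b - F a" using step[of "Suc n"] by simp
    moreover have "G b - G (b - h) \<le> K * norm h" "G (a - h) - G a \<le> K * norm h"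
      using lip[of b "b - h"] lip[of "a - h" a] by simp_all
    moreover have "norm h = norm (b - a) * inverse (real (Suc n))" unfolding h_def by simp
    ultimately show ?thesis by (simp add: algebra_simps)
  qed
  have "(\<lambda>n. F b - F a + 2 * K * norm (b - a) * inverse (real (Suc n)))
      \<longlonglongrightarrow> F b - F a + 2 * K * norm (b - a) * 0"
    by (intro tendsto_intros LIMSEQ_inverse_real_of_nat)
  then have "(\<lambda>n. F b - F a + 2 * K * norm (b - a) * inverse (real (Suc n))) \<longlonglongrightarrow> F b - F a"
    by simp
  then show ?thesis by (rule LIMSEQ_le_const) (use * in blast)
qed

text \<open>Since \<open>u + v - 2 y = (u - (y + h)) + (v - (y - h))\<close>, the bound of
  \<open>envelope_sum_le\<close> splits into a term in \<open>u\<close> and a term in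
  \<open>v\<close>. Their separate infima are the envelopes at \<open>y + h\<close> and
  \<open>y - h\<close>.\<close>

lemma envelope_increment_le:
  fixes f g :: "'a::banach \<Rightarrow> real"
  assumes conv: "convex_on D g" and lsc: "\<And>c. closed {x\<in>D. g x \<le> c}"
    and mg: "\<And>u. u \<in> D \<Longrightarrow> A - K0 * norm u \<le> g u"
    and mf: "\<And>u. u \<in> E \<Longrightarrow> B - K0 * norm u \<le> f u"
    and K: "K0 \<ge> 0" "K0 < K"
    and sub: "\<And>x p. x \<in> D \<Longrightarrow> bounded_linear p \<Longrightarrow> (\<And>u. u \<in> D \<Longrightarrow> p (u - x) \<le> g u - g x)
      \<Longrightarrow> x \<in> E \<and> (\<forall>u\<in>E. p (u - x) \<le> f u - f x)"
    and ne: "E \<noteq> {}" "D \<noteq> {}"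
  shows "envelope K D g b - envelope K D g a \<le> envelope K E f b - envelope K E f a"
proof (rule increment_le_of_sum_le)
  show "envelope K D g y - envelope K D g z \<le> K * norm (y - z)" for y z
    using K ne mg by (intro envelope_lipschitz) auto
  fix y h
  let ?s = "envelope K E f y + envelope K D g y"
  have *: "?s \<le> (f u + K * norm (u - (y + h))) + (g v + K * norm (v - (y - h)))"
    if u: "u \<in> E" and v: "v \<in> D" for u v
  proof -
    have "u + v - 2 *\<^sub>R y = (u - (y + h)) + (v - (y - h))" by (simp add: scaleR_2)
    then have "norm (u + v - 2 *\<^sub>R y) \<le> norm (u - (y + h)) + norm (v - (y - h))"
      using norm_triangle_ineq by metis
    then have "K * norm (u + v - 2 *\<^sub>R y) \<le> K * (norm (u - (y + h)) + norm (v - (y - h)))"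
      using K by (intro mult_left_mono) auto
    then show ?thesis using envelope_sum_le[OF conv lsc mg mf K sub u v, of y]
      by (simp add: algebra_simps)
  qed
  have "?s - envelope K D g (y - h) \<le> envelope K E f (y + h)"
  proof (rule envelope_greatest[OF ne(1)])
    fix u assume u: "u \<in> E"
    have "?s - (f u + K * norm (u - (y + h))) \<le> envelope K D g (y - h)"
      by (rule envelope_greatest[OF ne(2)]) (use *[OF u] in \<open>simp add: algebra_simps\<close>)
    then show "?s - envelope K D g (y - h) \<le> f u + K * norm (u - (y + h))" by simp
  qed
  then show "?s \<le> envelope K E f (y + h) + envelope K D g (y - h)" by simp
qed

section \<open>Passage to extended-real functions\<close>

lemma proper_fun_edom:
  assumes "proper_fun h" "x \<in> edom h" shows "h x = ereal (real_of_ereal (h x))"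
  using assms unfolding proper_fun_def edom_def by (cases "h x") auto

lemma closed_sublevel_real:
  assumes p: "proper_fun h" and l: "lsc h"
  shows "closed {x\<in>edom h. real_of_ereal (h x) \<le> c}"
proof -
  have "{x\<in>edom h. real_of_ereal (h x) \<le> c} = {x. h x \<le> ereal c}"
  proof (intro set_eqI)
    fix x show "x \<in> {x\<in>edom h. real_of_ereal (h x) \<le> c} \<longleftrightarrow> x \<in> {x. h x \<le> ereal c}"
      using p unfolding proper_fun_def edom_def by (cases "h x") auto
  qed
  then show ?thesis using l unfolding lsc_def by simp
qed

lemma convex_on_real_of_ereal:
  assumes p: "proper_fun h" and c: "econvex h"
  shows "convex_on (edom h) (\<lambda>x. real_of_ereal (h x))"
proof -
  have *: "h ((1 - t) *\<^sub>R x + t *\<^sub>R y)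
      \<le> ereal ((1 - t) * real_of_ereal (h x) + t * real_of_ereal (h y))"
    if "0 < t" "t < 1" "x \<in> edom h" "y \<in> edom h" for t x y
  proof -
    have "h ((1 - t) *\<^sub>R x + t *\<^sub>R y) \<le> ereal (1 - t) * h x + ereal t * h y"
      using c that unfolding econvex_def by blast
    also have "\<dots> = ereal ((1 - t) * real_of_ereal (h x) + t * real_of_ereal (h y))"
      using proper_fun_edom[OF p] that by (metis times_ereal.simps(1) plus_ereal.simps(1))
    finally show ?thesis .
  qed
  have mem: "(1 - t) *\<^sub>R x + t *\<^sub>R y \<in> edom h"
    if "0 < t" "t < 1" "x \<in> edom h" "y \<in> edom h" for t x y
    using *[OF that] unfolding edom_def by auto
  show ?thesis
  proof (rule convex_onI)
    show "convex (edom h)"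
      unfolding convex_alt
    proof (intro ballI allI impI)
      fix x y and u :: real assume xy: "x \<in> edom h" "y \<in> edom h" and u: "0 \<le> u \<and> u \<le> 1"
      \<comment> \<open>\<open>econvex\<close> speaks only of weights strictly between 0 and 1, so
        the endpoints are treated separately.\<close>
      show "(1 - u) *\<^sub>R x + u *\<^sub>R y \<in> edom h"
        by (cases "u = 0"; cases "u = 1") (use xy u mem in auto)
    qed
    fix t :: real and x y assume a: "0 < t" "t < 1" "x \<in> edom h" "y \<in> edom h"
    show "real_of_ereal (h ((1 - t) *\<^sub>R x + t *\<^sub>R y))
        \<le> (1 - t) * real_of_ereal (h x) + t * real_of_ereal (h y)"
      using *[OF a] proper_fun_edom[OF p mem[OF a]] by (metis ereal_less_eq(3))
  qed
qed

section \<open>Recovering the functions from their envelopes for large \<open>K\<close>\<close>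

text \<open>Within distance \<open>d\<close> of \<open>z\<close> lower semicontinuity keeps
  \<open>h\<close> above \<open>r\<close>; farther away the surplus slope \<open>K - K0\<close>
  lifts the penalized values above \<open>r\<close>. The value \<open>h z\<close> may be
  infinite.\<close>

lemma envelope_lower_bound:
  fixes h :: "'a::real_normed_vector \<Rightarrow> ereal"
  assumes p: "proper_fun h" and l: "lsc h" and r: "ereal r < h z"
    and m: "\<And>u. u \<in> edom h \<Longrightarrow> A - K0 * norm u \<le> real_of_ereal (h u)" and K0: "K0 \<ge> 0"
  shows "\<exists>K1. \<forall>K\<ge>K1. r \<le> envelope K (edom h) (\<lambda>x. real_of_ereal (h x)) z"
proof -
  have "open (- {x. h x \<le> ereal r})" using l unfolding lsc_def by (simp add: open_Compl)
  moreover have "z \<in> - {x. h x \<le> ereal r}" using r by simp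
  ultimately obtain d where d: "d > 0" "ball z d \<subseteq> - {x. h x \<le> ereal r}"
    using open_contains_ball by blast
  \<comment> \<open>The second entry makes \<open>(K - K0) * d\<close> at least
    \<open>r - A + K0 * norm z\<close>, the deficit of the minorant.\<close>
  define K1 where "K1 = max K0 (K0 + (r - A + K0 * norm z) / d)"
  have "r \<le> envelope K (edom h) (\<lambda>x. real_of_ereal (h x)) z" if K: "K \<ge> K1" for K
  proof (rule envelope_greatest)
    show "edom h \<noteq> {}" using p unfolding proper_fun_def by simp
    fix w assume w: "w \<in> edom h"
    have KK0: "K \<ge> K0" "K - K0 \<ge> (r - A + K0 * norm z) / d" using K unfolding K1_def by auto
    show "r \<le> real_of_ereal (h w) + K * norm (w - z)"
    proof (cases "norm (w - z) < d")
      case True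
      then have "w \<in> ball z d" by (simp add: dist_norm norm_minus_commute)
      then have "ereal r < h w" using d by auto
      then have "r < real_of_ereal (h w)" using proper_fun_edom[OF p w] by (metis less_ereal.simps(1))
      moreover have "0 \<le> K * norm (w - z)" using KK0 K0 by simp
      ultimately show ?thesis by simp
    next
      case False
      have "r - A + K0 * norm z \<le> (K - K0) * d" using KK0 d by (simp add: pos_divide_le_eq)
      also have "\<dots> \<le> (K - K0) * norm (w - z)" using False KK0 by (intro mult_left_mono) auto
      finally show ?thesis
        using norm_minorant_shift[of "edom h" A K0 "\<lambda>x. real_of_ereal (h x)" w z K] m K0 w by simp
    qed
  qed
  then show ?thesis by blast
qed

text \<open>As \<open>K\<close> grows, the envelopes of \<open>f\<close> at \<open>z\<close> and of
  \<open>g\<close> at \<open>a\<close> come close to the function values or exceed any given bound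
  below them, while the other two envelopes never exceed their functions. A single large
  \<open>K\<close> thus contradicts a failure of the inequality.\<close>

lemma le_add_const_of_envelope_increments:
  fixes f g :: "'a::real_normed_vector \<Rightarrow> ereal"
  defines "\<phi> \<equiv> \<lambda>x. real_of_ereal (f x)" and "\<gamma> \<equiv> \<lambda>x. real_of_ereal (g x)"
  assumes f: "proper_fun f" "lsc f" and g: "proper_fun g" "lsc g"
    and mg: "\<And>u. u \<in> edom g \<Longrightarrow> A - K0 * norm u \<le> \<gamma> u"
    and mf: "\<And>u. u \<in> edom f \<Longrightarrow> B - K0 * norm u \<le> \<phi> u" and K0: "K0 \<ge> 0"
    and a: "a \<in> edom f" "a \<in> edom g"
    and inc: "\<And>K. K > K0 \<Longrightarrow> envelope K (edom f) \<phi> z - envelope K (edom f) \<phi> a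
      \<le> envelope K (edom g) \<gamma> z - envelope K (edom g) \<gamma> a"
  shows "f z \<le> g z + ereal (\<phi> a - \<gamma> a)"
proof (cases "z \<in> edom g")
  case False
  then show ?thesis unfolding edom_def by simp
next
  case True
  define s where "s = \<gamma> z + (\<phi> a - \<gamma> a)"
  have gz: "g z = ereal (\<gamma> z)" and ga: "g a = ereal (\<gamma> a)"
    unfolding \<gamma>_def using proper_fun_edom[OF g(1)] True a by auto
  have "f z \<le> ereal s"
  proof (rule ccontr)
    assume "\<not> f z \<le> ereal s"
    then obtain r where r: "s < r" "ereal r < f z"
      using ereal_dense2[of "ereal s" "f z"] by (auto simp: not_le)
    obtain K1 where K1: "\<And>K. K \<ge> K1 \<Longrightarrow> r \<le> envelope K (edom f) \<phi> z"
      using envelope_lower_bound[OF f r(2) mf[unfolded \<phi>_def] K0] unfolding \<phi>_def by auto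
    \<comment> \<open>Granting half of the gap \<open>r - s\<close> to the error at \<open>a\<close>
      leaves the final inequality strictly violated.\<close>
    have "ereal (\<gamma> a - (r - s) / 2) < g a" using r ga by simp
    then obtain K2 where K2: "\<And>K. K \<ge> K2 \<Longrightarrow> \<gamma> a - (r - s) / 2 \<le> envelope K (edom g) \<gamma> a"
      using envelope_lower_bound[OF g _ mg[unfolded \<gamma>_def] K0] unfolding \<gamma>_def by blast
    define K where "K = max (K0 + 1) (max K1 K2)"
    have K: "K > K0" "K0 \<le> K" "K \<ge> K1" "K \<ge> K2" unfolding K_def by auto
    have "envelope K (edom f) \<phi> a \<le> \<phi> a"
      using envelope_le[OF mf K0 K(2) a(1), of a] by simp
    moreover have "envelope K (edom g) \<gamma> z \<le> \<gamma> z"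
      using envelope_le[OF mg K0 K(2) True, of z] by simp
    ultimately show False using K1[OF K(3)] K2[OF K(4)] inc[OF K(1)] r(1) unfolding s_def
      by (simp add: field_simps)
  qed
  then show ?thesis unfolding s_def gz by simp
qed

theorem theorem4p1:
  fixes f g :: "'a::banach \<Rightarrow> ereal"
  assumes "proper_fun f" "econvex f" "lsc f"
      and "proper_fun g" "econvex g" "lsc g"
      and "\<And>x. subdiff g x \<subseteq> subdiff f x"
  shows "\<exists>c::real. \<forall>x. f x = g x + ereal c"
proof -
  define \<phi> where "\<phi> = (\<lambda>x. real_of_ereal (f x))"
  define \<gamma> where "\<gamma> = (\<lambda>x. real_of_ereal (g x))"
  have feq: "\<And>x. x \<in> edom f \<Longrightarrow> f x = ereal (\<phi> x)" and geq: "\<And>x. x \<in> edom g \<Longrightarrow> g x = ereal (\<gamma> x)"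
    unfolding \<phi>_def \<gamma>_def using proper_fun_edom[OF assms(1)] proper_fun_edom[OF assms(4)] by blast+
  have conv: "convex_on (edom f) \<phi>" "convex_on (edom g) \<gamma>"
    unfolding \<phi>_def \<gamma>_def by (rule convex_on_real_of_ereal[OF assms(1,2)] convex_on_real_of_ereal[OF assms(4,5)])+
  have lsc: "\<And>c. closed {x\<in>edom f. \<phi> x \<le> c}" "\<And>c. closed {x\<in>edom g. \<gamma> x \<le> c}"
    unfolding \<phi>_def \<gamma>_def by (rule closed_sublevel_real[OF assms(1,3)] closed_sublevel_real[OF assms(4,6)])+
  have ne: "edom f \<noteq> {}" "edom g \<noteq> {}" using assms(1,4) unfolding proper_fun_def by auto
  then obtain x0 v where x0: "x0 \<in> edom f" and v: "v \<in> edom g" by blast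
  obtain K1 B where K1: "K1 \<ge> 0" "\<And>u. u \<in> edom f \<Longrightarrow> B - K1 * norm u \<le> \<phi> u"
    using norm_minorant_exists[OF conv(1) lsc(1) x0] by metis
  obtain K2 A where K2: "K2 \<ge> 0" "\<And>u. u \<in> edom g \<Longrightarrow> A - K2 * norm u \<le> \<gamma> u"
    using norm_minorant_exists[OF conv(2) lsc(2) v] by metis
  \<comment> \<open>The sum of the two slopes serves as a common slope for both minorants.\<close>
  define K0 where "K0 = K1 + K2"
  have K0: "K0 \<ge> 0" unfolding K0_def using K1 K2 by simp
  have mf: "B - K0 * norm u \<le> \<phi> u" if "u \<in> edom f" for u
    using K1(2)[OF that] K2(1) mult_nonneg_nonneg[OF K2(1) norm_ge_zero[of u]]
    unfolding K0_def distrib_right by linarith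
  have mg: "A - K0 * norm u \<le> \<gamma> u" if "u \<in> edom g" for u
    using K2(2)[OF that] K1(1) mult_nonneg_nonneg[OF K1(1) norm_ge_zero[of u]]
    unfolding K0_def distrib_right by linarith
  have sub: "x \<in> edom f \<and> (\<forall>u\<in>edom f. p (u - x) \<le> \<phi> u - \<phi> x)"
    if x: "x \<in> edom g" and p: "bounded_linear p" "\<And>u. u \<in> edom g \<Longrightarrow> p (u - x) \<le> \<gamma> u - \<gamma> x" for x p
  proof -
    have "ereal (p (u - x)) \<le> g u - g x" for u
    proof (cases "u \<in> edom g")
      case True
      then show ?thesis using p(2) geq x by simp
    next
      case False
      then have "g u = \<infinity>" unfolding edom_def by simp
      then show ?thesis using geq[OF x] by simp
    qed
    then have "p \<in> subdiff g x" using x p(1) unfolding subdiff_def by simp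
    then have *: "p \<in> subdiff f x" using assms(7) by blast
    then have xf: "x \<in> edom f" unfolding subdiff_def by (auto split: if_splits)
    have "p (u - x) \<le> \<phi> u - \<phi> x" if "u \<in> edom f" for u
    proof -
      have "ereal (p (u - x)) \<le> f u - f x" using * xf unfolding subdiff_def by simp
      then show ?thesis using feq xf that by simp
    qed
    then show ?thesis using xf by blast
  qed
  \<comment> \<open>A point with a subgradient of \<open>g\<close> lies in both domains: the
    inclusion makes the subdifferential of \<open>f\<close> nonempty there, and it is empty outside
    \<open>edom f\<close>.\<close>
  obtain a where a: "a \<in> edom f" "a \<in> edom g"
  proof -
    have K: "K0 < K0 + 1" by simp
    obtain x p where "x \<in> edom g" "bounded_linear p" "\<forall>u\<in>edom g. p (u - x) \<le> \<gamma> u - \<gamma> x"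
    proof (rule penalized_subgradient[OF conv(2) lsc(2) v mg K0 K])
      fix R
      assume R: "\<And>\<eta>. \<eta> > 0 \<Longrightarrow> \<exists>x\<in>edom g. \<exists>p. bounded_linear p \<and> (\<forall>u\<in>edom g. p (u - x) \<le> \<gamma> u - \<gamma> x)
        \<and> (\<forall>u. - (K0 + 1 + \<eta>) * norm u \<le> p u) \<and> (K0 + 1 - \<eta>) * norm (x - v) \<le> p (v - x)
        \<and> norm (x - v) \<le> R"
      show thesis using R[OF zero_less_one] that by blast
    qed
    then show ?thesis using sub that by blast
  qed
  \<comment> \<open>The endpoints are arbitrary; exchanging them gives the reverse inequality, so
    both comparisons below are available.\<close>
  have inc: "envelope K (edom g) \<gamma> z - envelope K (edom g) \<gamma> y
      \<le> envelope K (edom f) \<phi> z - envelope K (edom f) \<phi> y" if "K > K0" for K y z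
    using conv(2) lsc(2) mg mf K0 that sub ne by (rule envelope_increment_le)
  define c where "c = \<phi> a - \<gamma> a"
  have "f z = g z + ereal c" for z
  proof -
    have "f z \<le> g z + ereal c"
      unfolding c_def \<phi>_def \<gamma>_def
    proof (rule le_add_const_of_envelope_increments[OF assms(1,3,4,6) _ _ K0 a])
      fix K assume "K > K0"
      then show "envelope K (edom f) (\<lambda>x. real_of_ereal (f x)) z - envelope K (edom f) (\<lambda>x. real_of_ereal (f x)) a
        \<le> envelope K (edom g) (\<lambda>x. real_of_ereal (g x)) z - envelope K (edom g) (\<lambda>x. real_of_ereal (g x)) a"
        using inc[of K a z] unfolding \<phi>_def \<gamma>_def by simp
    qed (use mf mg in \<open>auto simp: \<phi>_def \<gamma>_def\<close>)
    moreover have "g z \<le> f z + ereal (\<gamma> a - \<phi> a)"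
      unfolding \<phi>_def \<gamma>_def
    proof (rule le_add_const_of_envelope_increments[OF assms(4,6,1,3) _ _ K0 a(2,1)])
      fix K assume "K > K0"
      then show "envelope K (edom g) (\<lambda>x. real_of_ereal (g x)) z - envelope K (edom g) (\<lambda>x. real_of_ereal (g x)) a
        \<le> envelope K (edom f) (\<lambda>x. real_of_ereal (f x)) z - envelope K (edom f) (\<lambda>x. real_of_ereal (f x)) a"
        using inc[of K z a] unfolding \<phi>_def \<gamma>_def by simp
    qed (use mf mg in \<open>auto simp: \<phi>_def \<gamma>_def\<close>)
    \<comment> \<open>The two bounds have opposite constants: they give equality at finite values
      and make \<open>f z\<close> and \<open>g z\<close> infinite together.\<close>
    ultimately show ?thesis unfolding c_def by (cases "f z"; cases "g z") auto
  qed
  then show ?thesis by blast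
qed

end
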